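(* For $\tau\in\mathbb{C}$ with $\operatorname{Im}\tau>0$ let $X_\tau=\mathbb{C}/(\mathbb{Z}+\tau\mathbb{Z})$ and let $X_{\tau,u}=X_\tau\setminus\{u\}$ be the once-punctured complex torus obtained by removing a point $u$. Let $K_{\tau,u}$ and $c_{\tau,u}$ be the Bergman kernel and the fundamental metric of $X_{\tau,u}$, respectively, with coefficients $K_{\tau,u}(w)$ and $c_{\tau,u}(w)$ in the local coordinate $w$ induced from $\mathbb{C}$ (i.e. $K_{\tau,u}=K_{\tau,u}(w)|dw|^2$, $c_{\tau,u}=c_{\tau,u}(w)|dw|^2$). Then, for fixed $u$ and fixed $w\in X_{\tau,u}$, as $\operatorname{Im}\tau\to+\infty$, $$\frac{\pi K_{\tau,u}(w)}{c_{\tau,u}^2(w)}\to 0^+ .$$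
   Context: Here $\to 0^+$ means tending to $0$ through positive values. Points are written in the coordinate induced from $\mathbb{C}$, i.e. $z,w,u$ also denote complex numbers representing them; $u$ and $w$ are fixed complex numbers with $w-u\notin\mathbb{Z}+\tau\mathbb{Z}$ for the $\tau$ under consideration. Bergman kernel: $K_{\tau,u}=\sum_j\varphi_j\otimes\overline{\varphi_j}$ for an orthonormal basis $(\varphi_j)$ of the space of holomorphic $1$-forms $\varphi$ on $X_{\tau,u}$ with finite norm $\|\varphi\|^2=i\int_{X_{\tau,u}}\varphi\wedge\overline{\varphi}$; if $\varphi_j=f_j(w)\,dw$ then $K_{\tau,u}(w)=\sum_j|f_j(w)|^2$. Evans-Selberg potential: on an open Riemann surface $\Sigma$, an Evans-Selberg potential with pole $q\in\Sigma$ is a real-valued function $E_q(p)$ such that (i) $E_q$ is harmonic on $\Sigma\setminus\{q\}$; (ii) $E_q(p)\to+\infty$ as $p$ tends to the Alexandroff ideal boundary point $a_\infty$; (iii) $E_q(p)-\log|\varphi(p)-\varphi(q)|$ is bounded near $q$, with $\varphi$ a local coordinate. Fundamental metric: in the local coordinate $z=\varphi(p)$ it is $c(z)|dz|^2:=\exp\lim_{q\to p}\big(E_q(p)-\log|\varphi(p)-\varphi(q)|\big)|dz|^2$. On $X_{\tau,u}$ the potential with pole $w$ used to form the fundamental metric is $$E^{\tau,u}_w(z)=\log\left|\frac{\theta_1(z-w;q)}{\theta_1(z-u;q)}\right|,$$ where $q=\exp(\pi i\tau)$, $q^{1/4}=\exp(\pi i\tau/4)$ and $\theta_1(z;q)=2q^{1/4}\sin(\pi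 z)\prod_{n=1}^\infty(1-q^{2n})(1-2\cos(2\pi z)q^{2n}+q^{4n})$; thus $c_{\tau,u}(w)=\exp\lim_{z\to w}\big(E^{\tau,u}_w(z)-\log|z-w|\big)$. *)

theory Defs
  imports "HOL-Analysis.Analysis"
begin

definition period_lattice :: "complex \<Rightarrow> complex set" where
  "period_lattice \<tau> = {of_int m + of_int n * \<tau> | m n :: int. True}"

definition lattice_rel :: "complex \<Rightarrow> complex rel" where
  "lattice_rel \<tau> = {(z, z'). z - z' \<in> period_lattice \<tau>}"

definition torus :: "complex \<Rightarrow> complex set set" where
  "torus \<tau> = UNIV // lattice_rel \<tau>"

definition torus_point :: "complex \<Rightarrow> complex \<Rightarrow> complex set" where
  "torus_point \<tau> z = lattice_rel \<tau> `` {z}"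

definition punctured_torus :: "complex \<Rightarrow> complex \<Rightarrow> complex set set" where
  "punctured_torus \<tau> u = torus \<tau> - {torus_point \<tau> u}"

definition fundamental_domain :: "complex \<Rightarrow> complex set" where
  "fundamental_domain \<tau> = {of_real s + of_real t * \<tau> | s t :: real. s \<in> {0..<1} \<and> t \<in> {0..<1}}"

text \<open>
  The form \<open>dz\<close> descends to a nowhere vanishing holomorphic 1-form on the torus, so every 1-form
  of type (1,0) on the punctured torus is \<open>F dz\<close> for a unique function \<open>F\<close> on it.  We represent
  the form by \<open>F\<close>; its coefficient in the coordinate induced from the complex plane is
  \<open>\<lambda>z. F (torus_point \<tau> z)\<close>.  Values of \<open>F\<close> off the punctured torus are irrelevant to everything below.
\<close>

definition holomorphic_form :: "complex \<Rightarrow> complex \<Rightarrow> (complex set \<Rightarrow> complex) \<Rightarrow> bool" where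
  "holomorphic_form \<tau> u F \<longleftrightarrow>
     (\<lambda>z. F (torus_point \<tau> z)) holomorphic_on {z. torus_point \<tau> z \<in> punctured_torus \<tau> u}"

text \<open>
  The inner product is \<open>i \<integral> \<phi> \<and> cnj \<psi>\<close>.  The factor 2 comes from \<open>i dz \<and> d(cnj z) = 2 dx \<and> dy\<close>.
  The point of the fundamental domain lying over the puncture is a null set.
\<close>

definition form_inner :: "complex \<Rightarrow> (complex set \<Rightarrow> complex) \<Rightarrow> (complex set \<Rightarrow> complex) \<Rightarrow> complex" where
  "form_inner \<tau> F G =
     2 * (LINT z:fundamental_domain \<tau>|lborel. F (torus_point \<tau> z) * cnj (G (torus_point \<tau> z)))"

definition form_norm_sq :: "complex \<Rightarrow> (complex set \<Rightarrow> complex) \<Rightarrow> real" where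
  "form_norm_sq \<tau> F = 2 * (LINT z:fundamental_domain \<tau>|lborel. (cmod (F (torus_point \<tau> z)))\<^sup>2)"

definition L2_holomorphic_forms :: "complex \<Rightarrow> complex \<Rightarrow> (complex set \<Rightarrow> complex) set" where
  "L2_holomorphic_forms \<tau> u =
     {F. holomorphic_form \<tau> u F \<and>
         set_integrable lborel (fundamental_domain \<tau>) (\<lambda>z. (cmod (F (torus_point \<tau> z)))\<^sup>2)}"

text \<open>Orthonormal basis in the Hilbert space sense: an orthonormal set with dense linear span.\<close>

definition orthonormal_basis :: "complex \<Rightarrow> complex \<Rightarrow> (complex set \<Rightarrow> complex) set \<Rightarrow> bool" where
  "orthonormal_basis \<tau> u B \<longleftrightarrow>
     B \<subseteq> L2_holomorphic_forms \<tau> u \<and>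
     (\<forall>F\<in>B. \<forall>G\<in>B. form_inner \<tau> F G = (if F = G then 1 else 0)) \<and>
     (\<forall>F\<in>L2_holomorphic_forms \<tau> u. \<forall>e>0. \<exists>S c. finite S \<and> S \<subseteq> B \<and>
        form_norm_sq \<tau> (\<lambda>p. F p - (\<Sum>G\<in>S. c G * G p)) < e)"

text \<open>The value does not depend on the choice of the orthonormal basis.\<close>

definition bergman_kernel :: "complex \<Rightarrow> complex \<Rightarrow> complex \<Rightarrow> real" where
  "bergman_kernel \<tau> u w =
     (\<Sum>\<^sub>\<infinity>F\<in>(SOME B. orthonormal_basis \<tau> u B). (cmod (F (torus_point \<tau> w)))\<^sup>2)"

text \<open>
  The parameter is \<open>\<tau>\<close> rather than the nome \<open>q\<close>, because \<open>q\<^sup>1\<^sup>/\<^sup>4\<close> means \<open>exp (\<pi> i \<tau> / 4)\<close>, which is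
  not a function of \<open>q\<close>.  The product index is shifted since \<^const>\<open>prodinf\<close> starts at 0.
\<close>

definition theta1 :: "complex \<Rightarrow> complex \<Rightarrow> complex" where
  "theta1 z \<tau> =
     (let q = exp (of_real pi * \<i> * \<tau>) in
      2 * exp (of_real pi * \<i> * \<tau> / 4) * sin (of_real pi * z) *
      (\<Prod>k. let n = Suc k in
         (1 - q ^ (2 * n)) * (1 - 2 * cos (2 * of_real pi * z) * q ^ (2 * n) + q ^ (4 * n))))"

text \<open>
  A function of the complex coordinate \<open>z\<close>, not of \<open>torus_point \<tau> z\<close>: under \<open>z \<mapsto> z + \<tau>\<close> it picks up
  the constant \<open>- 2 \<pi> Im (w - u)\<close>.  Only its behaviour near \<open>z = w\<close> enters the fundamental metric.
\<close>

definition evans_selberg_potential :: "complex \<Rightarrow> complex \<Rightarrow> complex \<Rightarrow> complex \<Rightarrow> real" where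
  "evans_selberg_potential \<tau> u w z = ln (cmod (theta1 (z - w) \<tau> / theta1 (z - u) \<tau>))"

definition fundamental_metric :: "complex \<Rightarrow> complex \<Rightarrow> complex \<Rightarrow> real" where
  "fundamental_metric \<tau> u w =
     exp (Lim (at w) (\<lambda>z. evans_selberg_potential \<tau> u w z - ln (cmod (z - w))))"

end

theory Submission
  imports Defs "HOL-Complex_Analysis.Complex_Analysis"
begin

text \<open>
  Numerator and denominator of the quotient have separate limits.

  The Bergman kernel does not see the puncture.  A square-integrable holomorphic form \<open>F dz\<close> on the
  punctured torus lifts to a doubly periodic function whose singularities, at the lifts of the
  puncture, are locally square-integrable.  Such singularities are removable
  (\<open>L2_isolated_singularity_removable\<close>), so Liouville's theorem makes the function constant
  (\<open>periodic_L2_holomorphic_constant\<close>).  As the fundamental parallelogram has area \<open>Im \<tau>\<close>, the form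
  \<open>dz\<close> has squared norm \<open>2 * Im \<tau>\<close>, and the kernel equals \<open>1 / (2 * Im \<tau>)\<close> (\<open>bergman_kernel_eq\<close>).
  This is positive and tends to \<open>0\<close>.

  The fundamental metric at \<open>w\<close> is \<open>norm (\<theta>\<^sub>1'(0) / \<theta>\<^sub>1(w - u))\<close>.  As \<open>Im \<tau>\<close> grows, the nome
  \<open>q = exp (\<pi> \<i> \<tau>)\<close> tends to \<open>0\<close> and the infinite products in this quotient tend to \<open>1\<close>, so the
  metric tends to the positive number \<open>\<pi> / norm (sin (\<pi> (w - u)))\<close>
  (\<open>fundamental_metric_tendsto\<close>).  The sine vanishes only if \<open>w - u\<close> is an integer, and then \<open>w\<close>
  represents the puncture for every \<open>\<tau>\<close>.

  Removability rests on the area mean value inequality \<open>norm_centre_le_disc_integral\<close>, which in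
  turn comes from the mean value property on circles and the rotation invariance of Lebesgue
  measure.  Rotations are products of shears, and the same shears compute the area of the
  parallelogram.
\<close>

section \<open>Shears and rotations preserve area in the complex plane\<close>

lemma lborel_complex_eq_distr_pair:
  "(lborel :: complex measure) = distr (lborel \<Otimes>\<^sub>M lborel) borel (\<lambda>(x, y). Complex x y)"
proof (rule lborel_eqI)
  have [measurable]: "(\<lambda>(x, y). Complex x y) \<in> borel_measurable (lborel \<Otimes>\<^sub>M lborel)"
    unfolding Complex_eq by measurable
  fix l u :: complex
  assume "\<And>b. b \<in> Basis \<Longrightarrow> l \<bullet> b \<le> u \<bullet> b"
  then have le: "Re l \<le> Re u" "Im l \<le> Im u"
    by (force simp: Basis_complex_def inner_complex_def)+
  have "(\<lambda>(x, y). Complex x y) -` box l u \<inter> space (lborel \<Otimes>\<^sub>M lborel)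
      = {Re l<..<Re u} \<times> {Im l<..<Im u}"
    by (auto simp: box_def Basis_complex_def space_pair_measure)
  then show "emeasure (distr (lborel \<Otimes>\<^sub>M lborel) borel (\<lambda>(x, y). Complex x y)) (box l u)
      = (\<Prod>b\<in>Basis. (u - l) \<bullet> b)"
    using le
    by (simp add: emeasure_distr lborel.emeasure_pair_measure_Times Basis_complex_def
        inner_complex_def ennreal_mult)
qed simp

lemma emeasure_lborel_complex:
  assumes [measurable]: "A \<in> sets borel"
  shows "emeasure lborel A = (\<integral>\<^sup>+ y. emeasure lborel {x. Complex x y \<in> A} \<partial>lborel)"
    and "emeasure lborel A = (\<integral>\<^sup>+ x. emeasure lborel {y. Complex x y \<in> A} \<partial>lborel)"
proof -
  have [measurable]: "(\<lambda>(x, y). Complex x y) \<in> borel_measurable (lborel \<Otimes>\<^sub>M lborel)"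
    unfolding Complex_eq by measurable
  let ?B = "(\<lambda>(x, y). Complex x y) -` A \<inter> space (lborel \<Otimes>\<^sub>M lborel)"
  have B: "?B \<in> sets (lborel \<Otimes>\<^sub>M lborel)" by measurable
  have A: "emeasure lborel A = emeasure (lborel \<Otimes>\<^sub>M lborel) ?B"
    by (subst lborel_complex_eq_distr_pair) (simp add: emeasure_distr)
  show "emeasure lborel A = (\<integral>\<^sup>+ y. emeasure lborel {x. Complex x y \<in> A} \<partial>lborel)"
    unfolding A lborel_pair.emeasure_pair_measure_alt2[OF B]
    by (intro nn_integral_cong arg_cong2[where f = emeasure]) (auto simp: space_pair_measure)
  show "emeasure lborel A = (\<integral>\<^sup>+ x. emeasure lborel {y. Complex x y \<in> A} \<partial>lborel)"
    unfolding A lborel.emeasure_pair_measure_alt[OF B]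
    by (intro nn_integral_cong arg_cong2[where f = emeasure]) (auto simp: space_pair_measure)
qed

lemma emeasure_lborel_vimage_plus:
  fixes c :: "'a :: euclidean_space"
  assumes "A \<in> sets borel"
  shows "emeasure lborel {x. c + x \<in> A} = emeasure lborel A"
proof -
  have "emeasure lborel A = emeasure (distr lborel borel ((+) c)) A"
    by (simp add: lborel_distr_plus)
  also have "\<dots> = emeasure lborel {x. c + x \<in> A}"
    using assms by (subst emeasure_distr) (auto simp: vimage_def)
  finally show ?thesis ..
qed

text \<open>
  On each line parallel to the shear direction a shear acts as a translation, so Fubini reduces the
  claim to translation invariance on the real line.  These maps serve twice: they compose to
  rotations, and one of them carries a rectangle onto the fundamental parallelogram.
\<close>

lemma distr_lborel_shear:
  fixes a :: real
  shows "distr lborel borel (\<lambda>z. z + of_real (a * Im z)) = (lborel :: complex measure)"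
    and "distr lborel borel (\<lambda>z. z + \<i> * of_real (a * Re z)) = (lborel :: complex measure)"
proof -
  have C [measurable]: "(\<lambda>x. Complex x y) \<in> borel_measurable borel"
    "(\<lambda>y. Complex x y) \<in> borel_measurable borel" for x y
    unfolding Complex_eq by measurable
  have [measurable]: "(\<lambda>z. z + of_real (a * Im z)) \<in> borel_measurable (borel :: complex measure)"
    "(\<lambda>z. z + \<i> * of_real (a * Re z)) \<in> borel_measurable (borel :: complex measure)"
    by (intro borel_measurable_continuous_onI continuous_intros)+
  show "distr lborel borel (\<lambda>z. z + of_real (a * Im z)) = (lborel :: complex measure)"
  proof (rule measure_eqI)
    fix A :: "complex set" assume "A \<in> sets (distr lborel borel (\<lambda>z. z + of_real (a * Im z)))"
    then have [measurable]: "A \<in> sets borel" by simp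
    have "emeasure (distr lborel borel (\<lambda>z. z + of_real (a * Im z))) A
        = emeasure lborel {z. z + of_real (a * Im z) \<in> A}"
      by (simp add: emeasure_distr vimage_def)
    also have "\<dots> = (\<integral>\<^sup>+ y. emeasure lborel {x. a * y + x \<in> {x. Complex x y \<in> A}} \<partial>lborel)"
      by (subst emeasure_lborel_complex(1)) (auto simp: Complex_eq algebra_simps)
    also have "\<dots> = (\<integral>\<^sup>+ y. emeasure lborel {x. Complex x y \<in> A} \<partial>lborel)"
      by (intro nn_integral_cong emeasure_lborel_vimage_plus) measurable
    also have "\<dots> = emeasure lborel A" by (simp add: emeasure_lborel_complex(1))
    finally show "emeasure (distr lborel borel (\<lambda>z. z + of_real (a * Im z))) A = emeasure lborel A" .
  qed simp
  show "distr lborel borel (\<lambda>z. z + \<i> * of_real (a * Re z)) = (lborel :: complex measure)"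
  proof (rule measure_eqI)
    fix A :: "complex set" assume "A \<in> sets (distr lborel borel (\<lambda>z. z + \<i> * of_real (a * Re z)))"
    then have [measurable]: "A \<in> sets borel" by simp
    have "emeasure (distr lborel borel (\<lambda>z. z + \<i> * of_real (a * Re z))) A
        = emeasure lborel {z. z + \<i> * of_real (a * Re z) \<in> A}"
      by (simp add: emeasure_distr vimage_def)
    also have "\<dots> = (\<integral>\<^sup>+ x. emeasure lborel {y. a * x + y \<in> {y. Complex x y \<in> A}} \<partial>lborel)"
      by (subst emeasure_lborel_complex(2)) (auto simp: Complex_eq algebra_simps)
    also have "\<dots> = (\<integral>\<^sup>+ x. emeasure lborel {y. Complex x y \<in> A} \<partial>lborel)"
      by (intro nn_integral_cong emeasure_lborel_vimage_plus) measurable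
    also have "\<dots> = emeasure lborel A" by (simp add: emeasure_lborel_complex(2))
    finally show "emeasure (distr lborel borel (\<lambda>z. z + \<i> * of_real (a * Re z))) A = emeasure lborel A" .
  qed simp
qed

text \<open>
  A rotation by an angle \<open>\<alpha>\<close> other than a multiple of \<open>\<pi>\<close> is a product of three shears,
  horizontal, vertical, horizontal, with coefficients \<open>- tan (\<alpha>/2)\<close>, \<open>sin \<alpha>\<close> and \<open>- tan (\<alpha>/2)\<close>;
  the half turn is the square of the quarter turn.
\<close>

lemma distr_lborel_rotation:
  fixes c :: complex
  assumes "norm c = 1"
  shows "distr lborel borel ((*) c) = lborel"
proof -
  have [measurable]: "(\<lambda>z. z + of_real (a * Im z)) \<in> borel_measurable (borel :: complex measure)"
    "(\<lambda>z. z + \<i> * of_real (a * Re z)) \<in> borel_measurable (borel :: complex measure)"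
    "((*) d) \<in> borel_measurable (borel :: complex measure)" for a d
    by (intro borel_measurable_continuous_onI continuous_intros)+
  have rot: "distr lborel borel ((*) d) = lborel" if d: "norm d = 1" "Im d \<noteq> 0" for d :: complex
  proof -
    \<comment> \<open>This is \<open>- tan (\<alpha>/2)\<close> for \<open>d = exp (\<i> \<alpha>)\<close>.\<close>
    define t where "t = (Re d - 1) / Im d"
    let ?S = "\<lambda>z :: complex. z + of_real (t * Im z)"
    let ?T = "\<lambda>z :: complex. z + \<i> * of_real (Im d * Re z)"
    have sq: "Re d * Re d + Im d * Im d = 1"
      using d(1) by (simp add: cmod_def power2_eq_square)
    have t: "t * (1 + Re d) = - Im d"
      using d(2) sq by (simp add: t_def field_simps)
    have t': "1 + Im d * t = Re d" using d(2) by (simp add: t_def)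
    have "d * z = ?S (?T (?S z))" for z
    proof (rule complex_eqI)
      have "Re (?S (?T (?S z))) = Re z * (1 + Im d * t) + Im z * (t * (1 + (1 + Im d * t)))"
        by (simp add: algebra_simps)
      then show "Re (d * z) = Re (?S (?T (?S z)))"
        unfolding t' t by (simp add: algebra_simps)
      have "Im (?S (?T (?S z))) = Im z * (1 + Im d * t) + Im d * Re z"
        by (simp add: algebra_simps)
      then show "Im (d * z) = Im (?S (?T (?S z)))"
        unfolding t' by (simp add: algebra_simps)
    qed
    then have "(*) d = ?S \<circ> (?T \<circ> ?S)" by (auto simp: fun_eq_iff)
    then have "distr lborel borel ((*) d) = distr (distr (distr lborel borel ?S) borel ?T) borel ?S"
      by (simp add: distr_distr)
    then show ?thesis by (simp only: distr_lborel_shear)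
  qed
  show ?thesis
  proof (cases "Im c = 0")
    case True
    then have "c = 1 \<or> c = -1"
      using assms by (auto simp: cmod_def complex_eq_iff)
    then show ?thesis
    proof
      assume "c = 1"
      then have "(*) c = (\<lambda>x. x)" by auto
      then show ?thesis by (simp add: distr_id2)
    next
      assume "c = -1"
      then have "(*) c = (*) \<i> \<circ> (*) \<i>" by (auto simp: fun_eq_iff)
      then have "distr lborel borel ((*) c) = distr (distr lborel borel ((*) \<i>)) borel ((*) \<i>)"
        by (simp add: distr_distr)
      then show ?thesis by (simp add: rot)
    qed
  qed (use rot assms in auto)
qed

section \<open>Area mean value inequality for holomorphic functions\<close>

lemma norm_centre_le_circle_average:
  assumes cont: "continuous_on (cball 0 1) g" and hol: "g holomorphic_on ball 0 1"
  shows "ennreal (norm (g 0)) \<le> (\<integral>\<^sup>+t\<in>{0..1}. norm (g (exp (2 * of_real pi * \<i> * of_real t))) \<partial>lborel)"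
proof -
  let ?e = "\<lambda>t :: real. exp (2 * of_real pi * \<i> * of_real t)"
  have ce: "continuous_on {0..1} (\<lambda>t. g (?e t))"
    by (rule continuous_on_compose2[OF cont])
       (auto intro!: continuous_intros simp: norm_exp_eq_Re)
  have "((\<lambda>u. g u / (u - 0)) has_contour_integral (2 * of_real pi * \<i> * g 0)) (circlepath 0 1)"
    by (rule Cauchy_integral_circlepath[OF cont hol]) simp
  then have "((\<lambda>t. 2 * of_real pi * \<i> * g (?e t)) has_integral (2 * of_real pi * \<i> * g 0)) {0..1}"
    unfolding has_contour_integral_def
    by (rule has_integral_eq[rotated])
       (simp only: vector_derivative_circlepath01 atLeastAtMost_iff, simp add: circlepath)
  from has_integral_mult_right[OF this, of "1 / (2 * of_real pi * \<i>)"]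
  have "((\<lambda>t. g (?e t)) has_integral g 0) {0..1}" by simp
  then have int: "integral {0..1} (\<lambda>t. g (?e t)) = g 0" by (rule integral_unique)
  have si: "set_integrable lborel {0..1} (\<lambda>t. g (?e t))"
    by (rule borel_integrable_atLeastAtMost'[OF ce])
  then have g0: "g 0 = (\<integral>t. indicator {0..1} t *\<^sub>R g (?e t) \<partial>lborel)"
    using set_borel_integral_eq_integral(2)[OF si] int by (simp add: set_lebesgue_integral_def)
  have "ennreal (norm (g 0)) \<le> (\<integral>\<^sup>+t. norm (indicator {0..1} t *\<^sub>R g (?e t)) \<partial>lborel)"
    by (subst g0) (rule integral_norm_bound_ennreal[OF si[unfolded set_integrable_def]])
  also have "\<dots> = (\<integral>\<^sup>+t\<in>{0..1}. norm (g (?e t)) \<partial>lborel)"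
    by (intro nn_integral_cong) (auto simp: indicator_def)
  finally show ?thesis .
qed

text \<open>
  For each \<open>x\<close> in the disc about \<open>0\<close>, the value \<open>norm (f z)\<close> is at most the average of \<open>norm f\<close> over
  the circle through \<open>z + x\<close> centred at \<open>z\<close>.  Integrating this over \<open>x\<close> and exchanging the two
  integrals leaves, for each angle, the integral of \<open>norm f\<close> over a rotated disc, which does not
  depend on the angle.  Rotation invariance thus takes the place of polar coordinates.
\<close>

lemma norm_centre_le_disc_integral:
  fixes f :: "complex \<Rightarrow> complex"
  assumes hol: "f holomorphic_on ball z r" and r: "0 \<le> r"
  shows "ennreal (pi * r\<^sup>2 * norm (f z)) \<le> (\<integral>\<^sup>+x\<in>ball z r. norm (f x) \<partial>lborel)"
proof -
  define G where "G x = ennreal (indicator (ball 0 r) x *\<^sub>R norm (f (z + x)))" for x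
  let ?e = "\<lambda>t :: real. exp (2 * of_real pi * \<i> * of_real t)"
  have ne: "norm (?e t) = 1" for t by (simp add: norm_exp_eq_Re)
  have cont: "continuous_on (ball 0 r) (\<lambda>x. norm (f (z + x)))"
    by (intro continuous_on_norm continuous_on_compose2[OF holomorphic_on_imp_continuous_on[OF hol]]
          continuous_intros) (auto simp: dist_norm)
  have [measurable]: "G \<in> borel_measurable borel"
    unfolding G_def by (intro measurable_compose[OF _ measurable_ennreal] 
      borel_measurable_continuous_on_indicator cont) simp
  have [measurable]: "(\<lambda>(x, t). ?e t * x) \<in> borel_measurable (lborel \<Otimes>\<^sub>M lborel)"
    unfolding lborel_prod split_beta by (simp, intro borel_measurable_continuous_onI continuous_intros)
  have [measurable]: "(\<lambda>x. ?e t * x) \<in> borel_measurable borel" for t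
    by (intro borel_measurable_continuous_onI continuous_intros)
  have vol: "emeasure lborel (ball 0 r :: complex set) = ennreal (pi * r\<^sup>2)"
    using r by (simp add: emeasure_ball eval_unit_ball_vol)
  have "ennreal (pi * r\<^sup>2 * norm (f z)) = (\<integral>\<^sup>+x. ennreal (norm (f z)) * indicator (ball (0 :: complex) r) x \<partial>lborel)"
    by (subst nn_integral_cmult_indicator) (auto simp: vol ennreal_mult' mult.commute)
  also have "\<dots> \<le> (\<integral>\<^sup>+x. \<integral>\<^sup>+t. indicator {0..1} t * G (?e t * x) \<partial>lborel \<partial>lborel)"
  proof (rule nn_integral_mono)
    fix x :: complex
    show "ennreal (norm (f z)) * indicator (ball 0 r) x \<le> (\<integral>\<^sup>+t. indicator {0..1} t * G (?e t * x) \<partial>lborel)"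
    proof (cases "x \<in> ball 0 r")
      case True
      then have sub: "z + y * x \<in> ball z r" if "norm y \<le> 1" for y
        using mult_right_mono[OF that norm_ge_zero[of x]] by (simp add: dist_norm norm_mult)
      \<comment> \<open>The circle through \<open>z + x\<close> is parametrised by the unit circle, which also covers \<open>x = 0\<close>.\<close>
      have hg: "(\<lambda>y. f (z + y * x)) holomorphic_on cball 0 1"
        using sub by (intro holomorphic_on_compose_gen[OF _ hol, unfolded o_def] holomorphic_intros) auto
      have "ennreal (norm (f (z + 0 * x)))
        \<le> (\<integral>\<^sup>+t\<in>{0..1}. norm (f (z + ?e t * x)) \<partial>lborel)"
        by (rule norm_centre_le_circle_average[where g = "\<lambda>y. f (z + y * x)"])
           (auto intro: holomorphic_on_imp_continuous_on[OF hg] holomorphic_on_subset[OF hg])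
      also have "\<dots> = (\<integral>\<^sup>+t. indicator {0..1} t * G (?e t * x) \<partial>lborel)"
        using True by (intro nn_integral_cong) (auto simp: G_def indicator_def norm_mult ne)
      finally show ?thesis using True by simp
    qed simp
  qed
  also have "\<dots> = (\<integral>\<^sup>+t. \<integral>\<^sup>+x. indicator {0..1} t * G (?e t * x) \<partial>lborel \<partial>lborel)"
    by (rule lborel_pair.Fubini'[symmetric]) measurable
  also have "\<dots> = (\<integral>\<^sup>+t. indicator {0..1::real} t * (\<integral>\<^sup>+x. G x \<partial>lborel) \<partial>lborel)"
  proof (rule nn_integral_cong)
    fix t :: real
    have "(\<integral>\<^sup>+x. G x \<partial>lborel) = (\<integral>\<^sup>+x. G x \<partial>distr lborel borel ((*) (?e t)))"
      by (simp add: distr_lborel_rotation ne)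
    also have "\<dots> = (\<integral>\<^sup>+x. G (?e t * x) \<partial>lborel)"
      by (rule nn_integral_distr) simp_all
    finally show "(\<integral>\<^sup>+x. indicator {0..1} t * G (?e t * x) \<partial>lborel) = indicator {0..1} t * (\<integral>\<^sup>+x. G x \<partial>lborel)"
      by (simp add: nn_integral_cmult)
  qed
  also have "\<dots> = (\<integral>\<^sup>+x. G x \<partial>lborel)"
    by (simp add: nn_integral_multc)
  also have "\<dots> = (\<integral>\<^sup>+x. indicator (ball z r) (z + x) * ennreal (norm (f (z + x))) \<partial>lborel)"
    by (intro nn_integral_cong) (auto simp: G_def indicator_def dist_norm)
  also have "\<dots> = (\<integral>\<^sup>+x. indicator (ball z r) x * ennreal (norm (f x)) \<partial>distr lborel borel ((+) z))"
  proof (rule nn_integral_distr[symmetric])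
    have "(\<lambda>x. ennreal (indicator (ball z r) x *\<^sub>R norm (f x))) \<in> borel_measurable borel"
      by (intro measurable_compose[OF _ measurable_ennreal] borel_measurable_continuous_on_indicator
            continuous_on_norm holomorphic_on_imp_continuous_on[OF hol]) simp
    also have "(\<lambda>x. ennreal (indicator (ball z r) x *\<^sub>R norm (f x))) 
        = (\<lambda>x. indicator (ball z r) x * ennreal (norm (f x)))"
      by (auto simp: indicator_def)
    finally show "(\<lambda>x. indicator (ball z r) x * ennreal (norm (f x)))
       \<in> borel_measurable (distr lborel borel ((+) z))" by simp
  qed simp
  finally show ?thesis by (simp add: lborel_distr_plus mult.commute)
qed

section \<open>Square-integrable isolated singularities are removable\<close>

text \<open>
  Absolute continuity of the integral, in the punctured form that fits isolated singularities.
\<close>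

lemma integral_shrinking_balls_tendsto_0:
  fixes h :: "'a :: euclidean_space \<Rightarrow> real"
  assumes int: "set_integrable lborel (ball u R) h" and R: "0 < R" and "0 < e"
  obtains r where "0 < r" "r \<le> R" "(\<integral>\<^sup>+x\<in>ball u r - {u}. ennreal \<bar>h x\<bar> \<partial>lborel) < ennreal e"
proof -
  define s where "s n = (\<lambda>x. indicator (ball u (R / Suc n) - {u}) x *\<^sub>R \<bar>h x\<bar>)" for n
  have R_le: "R / Suc n \<le> R" for n using R by (simp add: field_simps)
  have sint: "set_integrable lborel (ball u (R / Suc n) - {u}) (\<lambda>x. \<bar>h x\<bar>)" for n
  proof (rule set_integrable_subset[OF set_integrable_abs[OF int]])
    show "ball u (R / Suc n) - {u} \<subseteq> ball u R" using R_le[of n] by auto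
  qed auto
  have "(\<lambda>n. \<integral>x. s n x \<partial>lborel) \<longlonglongrightarrow> (\<integral>x. 0 \<partial>(lborel :: 'a measure))"
  proof (rule integral_dominated_convergence)
    show "s n \<in> borel_measurable lborel" for n
      using sint[of n] by (simp add: s_def set_integrable_def integrable_iff_bounded)
    show "integrable lborel (\<lambda>x. indicator (ball u R) x *\<^sub>R \<bar>h x\<bar>)"
      using set_integrable_abs[OF int] by (simp add: set_integrable_def)
    show "AE x in lborel. (\<lambda>n. s n x) \<longlonglongrightarrow> 0"
    proof (rule AE_I2)
      fix x :: 'a
      have "(\<lambda>n. R / Suc n) \<longlonglongrightarrow> 0"
        using tendsto_mult[OF tendsto_const[of R] LIMSEQ_inverse_real_of_nat]
        by (simp add: divide_inverse)
      then have "eventually (\<lambda>n. R / Suc n < dist u x) sequentially" if "x \<noteq> u"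
        using that by (intro order_tendstoD(2)) auto
      then have "eventually (\<lambda>n. s n x = 0) sequentially"
        by (cases "x = u") (auto simp: s_def elim!: eventually_mono)
      then show "(\<lambda>n. s n x) \<longlonglongrightarrow> 0" by (rule tendsto_eventually)
    qed
    show "AE x in lborel. norm (s n x) \<le> indicator (ball u R) x *\<^sub>R \<bar>h x\<bar>" for n
      using R_le[of n] by (intro AE_I2) (auto simp: s_def indicator_def)
  qed simp
  then have "eventually (\<lambda>n. (\<integral>x. s n x \<partial>lborel) < e) sequentially"
    using \<open>0 < e\<close> by (intro order_tendstoD(2)) auto
  then obtain n where n: "(\<integral>x. s n x \<partial>lborel) < e"
    using eventually_happens by force
  have "(\<integral>\<^sup>+x\<in>ball u (R / Suc n) - {u}. ennreal \<bar>h x\<bar> \<partial>lborel) = (\<integral>\<^sup>+x. ennreal (s n x) \<partial>lborel)"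
    by (intro nn_integral_cong) (auto simp: s_def indicator_def)
  also have "\<dots> = ennreal (\<integral>x. s n x \<partial>lborel)"
    using sint[of n] by (intro nn_integral_eq_integral) (auto simp: s_def set_integrable_def)
  also have "\<dots> < ennreal e" using n \<open>0 < e\<close> by (simp add: ennreal_lessI)
  finally show ?thesis using R R_le[of n] by (intro that[of "R / Suc n"]) auto
qed

text \<open>
  The mean value inequality for \<open>f\<^sup>2\<close> on the disc of radius \<open>d = norm (z - u)\<close> about \<open>z\<close>, which omits
  \<open>u\<close> and lies in the ball of radius \<open>2 d\<close> about \<open>u\<close>, bounds \<open>\<pi> d\<^sup>2 norm (f z)\<^sup>2\<close> by an integral of
  \<open>norm f ^ 2\<close> that tends to \<open>0\<close> with \<open>d\<close>.  So \<open>(z - u) * f z\<close> tends to \<open>0\<close>, and Riemann's theorem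
  applies.
\<close>

lemma L2_isolated_singularity_removable:
  assumes hol: "f holomorphic_on ball u R - {u}" and R: "0 < R"
    and int: "set_integrable lborel (ball u R) (\<lambda>z. (norm (f z))\<^sup>2)"
  obtains g where "g holomorphic_on ball u R" "\<And>z. z \<in> ball u R - {u} \<Longrightarrow> g z = f z"
proof -
  have "((\<lambda>z. (z - u) * f z) \<longlongrightarrow> 0) (at u)"
  proof (rule LIM_I)
    fix e :: real assume "0 < e"
    then have e2: "0 < pi * e\<^sup>2 / 4" by simp
    obtain r where r: "0 < r" "r \<le> R"
      and le: "(\<integral>\<^sup>+x\<in>ball u r - {u}. ennreal \<bar>(norm (f x))\<^sup>2\<bar> \<partial>lborel) < ennreal (pi * e\<^sup>2 / 4)"
      by (rule integral_shrinking_balls_tendsto_0[OF int R e2])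
    show "\<exists>s>0. \<forall>z. z \<noteq> u \<and> norm (z - u) < s \<longrightarrow> norm ((z - u) * f z - 0) < e"
    proof (intro exI[of _ "r / 2"] conjI allI impI)
      fix z assume z: "z \<noteq> u \<and> norm (z - u) < r / 2"
      define d where "d = norm (z - u)"
      have d: "0 < d" "d < r / 2" using z by (auto simp: d_def)
      have sub: "ball z d \<subseteq> ball u r - {u}"
      proof
        fix x assume "x \<in> ball z d"
        then have x: "norm (z - x) < d" by (simp add: dist_norm)
        then have "x \<noteq> u" by (auto simp: d_def)
        moreover have "norm (u - x) \<le> norm (z - u) + norm (z - x)"
          using norm_triangle_ineq4[of "z - x" "z - u"] by (simp add: algebra_simps)
        then have "norm (u - x) < r" using x d by (simp add: d_def)
        ultimately show "x \<in> ball u r - {u}" by (simp add: dist_norm)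
      qed
      have "ball u r - {u} \<subseteq> ball u R - {u}" using r by auto
      then have "(\<lambda>x. (f x)\<^sup>2) holomorphic_on ball z d"
        using sub by (intro holomorphic_intros holomorphic_on_subset[OF hol]) auto
      then have "ennreal (pi * d\<^sup>2 * norm ((f z)\<^sup>2)) \<le> (\<integral>\<^sup>+x\<in>ball z d. norm ((f x)\<^sup>2) \<partial>lborel)"
        using d by (intro norm_centre_le_disc_integral) auto
      also have "\<dots> \<le> (\<integral>\<^sup>+x\<in>ball u r - {u}. ennreal \<bar>(norm (f x))\<^sup>2\<bar> \<partial>lborel)"
        using sub by (intro nn_integral_mono) (auto simp: indicator_def norm_power)
      also note le
      finally have "pi * d\<^sup>2 * norm ((f z)\<^sup>2) < pi * e\<^sup>2 / 4"
        using e2 by (subst (asm) ennreal_less_iff) auto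
      then have "(d * norm (f z))\<^sup>2 < (e / 2)\<^sup>2"
        by (simp add: norm_power power_mult_distrib power_divide)
      then have "d * norm (f z) < e / 2"
        using \<open>0 < e\<close> by (intro power2_less_imp_less[of _ "e / 2"]) simp_all
      then show "norm ((z - u) * f z - 0) < e"
        using \<open>0 < e\<close> by (simp add: norm_mult d_def)
    qed (use r in auto)
  qed
  then have "\<exists>g. g holomorphic_on ball u R \<and> (\<forall>z\<in>ball u R - {u}. g z = f z)"
    using R by (subst holomorphic_on_extend_lim[OF hol]) auto
  then show ?thesis using that by blast
qed

section \<open>The period lattice and the fundamental domain\<close>

lemma period_latticeI: "of_int m + of_int n * \<tau> \<in> period_lattice \<tau>"
  unfolding period_lattice_def by blast

lemma zero_in_period_lattice [simp]: "0 \<in> period_lattice \<tau>"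
  using period_latticeI[of 0 0 \<tau>] by simp

lemma diff_in_period_lattice:
  assumes "l \<in> period_lattice \<tau>" "l' \<in> period_lattice \<tau>"
  shows "l - l' \<in> period_lattice \<tau>"
proof -
  obtain m n m' n' where "l = of_int m + of_int n * \<tau>" "l' = of_int m' + of_int n' * \<tau>"
    using assms unfolding period_lattice_def by blast
  then have "l - l' = of_int (m - m') + of_int (n - n') * \<tau>"
    by (simp add: algebra_simps)
  then show ?thesis by (metis period_latticeI)
qed

lemma uminus_in_period_lattice: "l \<in> period_lattice \<tau> \<Longrightarrow> - l \<in> period_lattice \<tau>"
  using diff_in_period_lattice[of 0 \<tau> l] by simp

lemma add_in_period_lattice:
  "l \<in> period_lattice \<tau> \<Longrightarrow> l' \<in> period_lattice \<tau> \<Longrightarrow> l + l' \<in> period_lattice \<tau>"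
  using diff_in_period_lattice[of l \<tau> "- l'"] uminus_in_period_lattice[of l' \<tau>] by simp

lemma countable_period_lattice: "countable (period_lattice \<tau>)"
proof -
  have "period_lattice \<tau> = (\<lambda>(m, n). of_int m + of_int n * \<tau>) ` UNIV"
    unfolding period_lattice_def by auto
  then show ?thesis by simp
qed

text \<open>
  Discreteness of the lattice: a period that is not an integer has imaginary part at least \<open>Im \<tau>\<close>
  in absolute value.
\<close>

lemma norm_period_lattice_ge:
  assumes "0 < Im \<tau>" "l \<in> period_lattice \<tau>" "l \<noteq> 0"
  shows "min 1 (Im \<tau>) \<le> norm l"
proof -
  obtain m n where l: "l = of_int m + of_int n * \<tau>"
    using assms unfolding period_lattice_def by blast
  show ?thesis
  proof (cases "n = 0")
    case True
    then have "1 \<le> \<bar>real_of_int m\<bar>" using assms l by auto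
    then show ?thesis using True l by simp
  next
    case False
    then have "1 \<le> \<bar>real_of_int n\<bar>" by auto
    then have "Im \<tau> \<le> \<bar>Im l\<bar>"
      using assms l by (simp add: abs_mult)
    also have "\<dots> \<le> norm l" by (rule abs_Im_le_cmod)
    finally show ?thesis by simp
  qed
qed

lemma torus_point_eq_iff: "torus_point \<tau> z = torus_point \<tau> u \<longleftrightarrow> z - u \<in> period_lattice \<tau>"
proof
  assume eq: "torus_point \<tau> z = torus_point \<tau> u"
  have "u \<in> torus_point \<tau> u" by (simp add: torus_point_def lattice_rel_def)
  then have "u \<in> torus_point \<tau> z" using eq by simp
  then show "z - u \<in> period_lattice \<tau>" by (simp add: torus_point_def lattice_rel_def)
next
  assume l: "z - u \<in> period_lattice \<tau>"
  have "z - x \<in> period_lattice \<tau> \<longleftrightarrow> u - x \<in> period_lattice \<tau>" for x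
    using diff_in_period_lattice[OF _ l, of "z - x"] add_in_period_lattice[OF l, of "u - x"] by auto
  then show "torus_point \<tau> z = torus_point \<tau> u" by (auto simp: torus_point_def lattice_rel_def)
qed

lemma torus_point_in_punctured_torus_iff:
  "torus_point \<tau> z \<in> punctured_torus \<tau> u \<longleftrightarrow> z - u \<notin> period_lattice \<tau>"
proof -
  have "torus_point \<tau> z \<in> torus \<tau>" by (auto simp: torus_def torus_point_def quotient_def)
  then show ?thesis by (simp add: punctured_torus_def torus_point_eq_iff)
qed

lemma in_fundamental_domain_iff:
  assumes "0 < Im \<tau>"
  shows "z \<in> fundamental_domain \<tau> \<longleftrightarrow>
    0 \<le> Re z - Im z / Im \<tau> * Re \<tau> \<and> Re z - Im z / Im \<tau> * Re \<tau> < 1 \<and> 0 \<le> Im z \<and> Im z < Im \<tau>"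
proof
  assume "z \<in> fundamental_domain \<tau>"
  then obtain s t where "z = of_real s + of_real t * \<tau>" "s \<in> {0..<1}" "t \<in> {0..<1}"
    unfolding fundamental_domain_def by blast
  then show "0 \<le> Re z - Im z / Im \<tau> * Re \<tau> \<and> Re z - Im z / Im \<tau> * Re \<tau> < 1 \<and> 0 \<le> Im z \<and> Im z < Im \<tau>"
    using assms by simp
next
  assume *: "0 \<le> Re z - Im z / Im \<tau> * Re \<tau> \<and> Re z - Im z / Im \<tau> * Re \<tau> < 1 \<and> 0 \<le> Im z \<and> Im z < Im \<tau>"
  have "z = of_real (Re z - Im z / Im \<tau> * Re \<tau>) + of_real (Im z / Im \<tau>) * \<tau>"
    using assms by (simp add: complex_eq_iff)
  moreover have "Re z - Im z / Im \<tau> * Re \<tau> \<in> {0..<1}" "Im z / Im \<tau> \<in> {0..<1}"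
    using * assms by auto
  ultimately show "z \<in> fundamental_domain \<tau>"
    unfolding fundamental_domain_def by blast
qed

lemma translate_into_fundamental_domain:
  assumes "0 < Im \<tau>"
  shows "z - (of_int \<lfloor>Re z - Im z / Im \<tau> * Re \<tau>\<rfloor> + of_int \<lfloor>Im z / Im \<tau>\<rfloor> * \<tau>) \<in> fundamental_domain \<tau>"
proof -
  define s t where "s = Re z - Im z / Im \<tau> * Re \<tau>" and "t = Im z / Im \<tau>"
  have "z = of_real s + of_real t * \<tau>"
    using assms by (simp add: complex_eq_iff s_def t_def)
  then have "z - (of_int \<lfloor>s\<rfloor> + of_int \<lfloor>t\<rfloor> * \<tau>) = of_real (frac s) + of_real (frac t) * \<tau>"
    by (simp add: frac_def algebra_simps)
  moreover have "frac s \<in> {0..<1}" "frac t \<in> {0..<1}" by (auto simp: frac_lt_1)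
  ultimately show ?thesis
    unfolding fundamental_domain_def s_def t_def by blast
qed

lemma fundamental_domain_borel:
  assumes "0 < Im \<tau>"
  shows "fundamental_domain \<tau> \<in> sets borel"
proof -
  have "fundamental_domain \<tau> = {z \<in> space borel. 0 \<le> Re z - Im z / Im \<tau> * Re \<tau> \<and>
      Re z - Im z / Im \<tau> * Re \<tau> < 1 \<and> 0 \<le> Im z \<and> Im z < Im \<tau>}"
    using in_fundamental_domain_iff[OF assms] by auto
  also have "\<dots> \<in> sets borel" by measurable
  finally show ?thesis .
qed

lemma emeasure_fundamental_domain:
  assumes \<tau>: "0 < Im \<tau>"
  shows "emeasure lborel (fundamental_domain \<tau>) = ennreal (Im \<tau>)"
proof -
  define S where "S z = z + of_real (Re \<tau> / Im \<tau> * Im z)" for z :: complex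
  have S [measurable]: "S \<in> borel_measurable borel"
    unfolding S_def by (intro borel_measurable_continuous_onI continuous_intros)
  have D: "fundamental_domain \<tau> \<in> sets borel" by (rule fundamental_domain_borel[OF \<tau>])
  have eq: "S -` fundamental_domain \<tau> = {z. 0 \<le> Re z \<and> Re z < 1 \<and> 0 \<le> Im z \<and> Im z < Im \<tau>}"
    by (auto simp: in_fundamental_domain_iff[OF \<tau>] S_def)
  have "S -` fundamental_domain \<tau> \<in> sets borel"
    using measurable_sets[OF S D] by simp
  then have [measurable]: "{z :: complex. 0 \<le> Re z \<and> Re z < 1 \<and> 0 \<le> Im z \<and> Im z < Im \<tau>} \<in> sets borel"
    by (simp add: eq)
  have "emeasure lborel (fundamental_domain \<tau>) = emeasure (distr lborel borel S) (fundamental_domain \<tau>)"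
    unfolding S_def distr_lborel_shear ..
  also have "\<dots> = emeasure lborel {z :: complex. 0 \<le> Re z \<and> Re z < 1 \<and> 0 \<le> Im z \<and> Im z < Im \<tau>}"
    using D by (simp add: emeasure_distr eq)
  also have "\<dots> = (\<integral>\<^sup>+ y. emeasure lborel {x :: real. 0 \<le> x \<and> x < 1 \<and> 0 \<le> y \<and> y < Im \<tau>} \<partial>lborel)"
    by (subst emeasure_lborel_complex(1)) simp_all
  also have "\<dots> = (\<integral>\<^sup>+ y. indicator {0..<Im \<tau>} y \<partial>lborel)"
  proof (rule nn_integral_cong)
    fix y :: real
    have "{x :: real. 0 \<le> x \<and> x < 1 \<and> 0 \<le> y \<and> y < Im \<tau>} = (if 0 \<le> y \<and> y < Im \<tau> then {0..<1} else {})"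
      by auto
    then show "emeasure lborel {x :: real. 0 \<le> x \<and> x < 1 \<and> 0 \<le> y \<and> y < Im \<tau>} = indicator {0..<Im \<tau>} y"
      by (simp add: indicator_def)
  qed
  also have "\<dots> = ennreal (Im \<tau>)" using \<tau> by simp
  finally show ?thesis .
qed

section \<open>Doubly periodic square-integrable functions with punctures\<close>

text \<open>
  Passes from the parallelogram, whose interior need not contain any lift of the puncture, to a
  full ball around a lift: finitely many translates of the parallelogram cover the ball.
\<close>

lemma set_integrable_ball_of_periodic:
  fixes h :: "complex \<Rightarrow> real"
  assumes \<tau>: "0 < Im \<tau>"
    and per: "\<And>z l. l \<in> period_lattice \<tau> \<Longrightarrow> h (z + l) = h z"
    and int: "set_integrable lborel (fundamental_domain \<tau>) h"
  shows "set_integrable lborel (ball a r) h"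
proof -
  define s t where "s z = Re z - Im z / Im \<tau> * Re \<tau>" and "t z = Im z / Im \<tau>" for z
  define A where "A = (\<lambda>(m, n). {z. z - (of_int m + of_int n * \<tau>) \<in> fundamental_domain \<tau>})"
  define J where "J = (\<lambda>z. (\<lfloor>s z\<rfloor>, \<lfloor>t z\<rfloor>)) ` cball a r"
  have bnd: "\<exists>B. \<forall>z\<in>cball a r. \<bar>g z\<bar> \<le> B" if "continuous_on UNIV g" for g :: "complex \<Rightarrow> real"
    using compact_imp_bounded[OF compact_continuous_image[OF continuous_on_subset[OF that] compact_cball]]
    by (auto simp: bounded_iff)
  have "continuous_on UNIV s" "continuous_on UNIV t"
    using \<tau> unfolding s_def t_def by (auto intro!: continuous_intros)
  then obtain B C where B: "\<And>z. z \<in> cball a r \<Longrightarrow> \<bar>s z\<bar> \<le> B" and C: "\<And>z. z \<in> cball a r \<Longrightarrow> \<bar>t z\<bar> \<le> C"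
    using bnd by meson
  have fl: "\<lfloor>x\<rfloor> \<in> {\<lfloor>-K\<rfloor>..\<lfloor>K\<rfloor>}" if "\<bar>x\<bar> \<le> K" for x K :: real
    using that by (auto intro!: floor_mono)
  have "J \<subseteq> {\<lfloor>-B\<rfloor>..\<lfloor>B\<rfloor>} \<times> {\<lfloor>-C\<rfloor>..\<lfloor>C\<rfloor>}"
    unfolding J_def using fl[OF B] fl[OF C] by auto
  then have finJ: "finite J" by (rule finite_subset) auto
  have sub: "ball a r \<subseteq> (\<Union>p\<in>J. A p)"
  proof
    fix z assume "z \<in> ball a r"
    then have "(\<lfloor>s z\<rfloor>, \<lfloor>t z\<rfloor>) \<in> J" by (auto simp: J_def)
    moreover have "z \<in> A (\<lfloor>s z\<rfloor>, \<lfloor>t z\<rfloor>)"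
      using translate_into_fundamental_domain[OF \<tau>, of z] by (simp add: A_def s_def t_def)
    ultimately show "z \<in> (\<Union>p\<in>J. A p)" by blast
  qed
  note [measurable] = fundamental_domain_borel[OF \<tau>]
  have Am: "A p \<in> sets lborel" for p
    by (cases p) (simp add: A_def)
  have Aint: "set_integrable lborel (A p) h" for p
  proof -
    obtain m n where p: "p = (m, n)" by (cases p)
    define l where "l = of_int m + of_int n * \<tau>"
    have l: "l \<in> period_lattice \<tau>" by (simp add: l_def period_latticeI)
    have "integrable (distr lborel borel ((+) (- l))) (\<lambda>z. indicator (fundamental_domain \<tau>) z *\<^sub>R h z)"
      using int by (simp add: lborel_distr_plus set_integrable_def)
    then have "integrable lborel (\<lambda>z. indicator (fundamental_domain \<tau>) (- l + z) *\<^sub>R h (- l + z))"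
      by (rule integrable_distr[rotated]) simp
    moreover have "indicator (fundamental_domain \<tau>) (- l + z) *\<^sub>R h (- l + z) = indicator (A p) z *\<^sub>R h z" for z
      using per[OF uminus_in_period_lattice[OF l], of z]
      by (simp add: A_def p l_def indicator_def algebra_simps)
    ultimately show ?thesis by (simp add: set_integrable_def)
  qed
  have "set_integrable lborel (\<Union>p\<in>J. A p) h"
    by (rule set_integrable_UN[OF finJ]) (use Am Aint in auto)
  then show ?thesis by (rule set_integrable_subset) (use sub in auto)
qed

text \<open>
  By square-integrability the singularity at \<open>u\<close> is removable, and periodicity transports the
  extension to all lifts of the puncture.  The resulting entire function is periodic, hence bounded
  by its maximum on the compact parallelogram, hence constant.
\<close>

lemma periodic_L2_holomorphic_constant:
  assumes \<tau>: "0 < Im \<tau>"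
    and hol: "f holomorphic_on {z. z - u \<notin> period_lattice \<tau>}"
    and per: "\<And>z l. l \<in> period_lattice \<tau> \<Longrightarrow> f (z + l) = f z"
    and int: "set_integrable lborel (fundamental_domain \<tau>) (\<lambda>z. (norm (f z))\<^sup>2)"
  obtains c where "\<And>z. z - u \<notin> period_lattice \<tau> \<Longrightarrow> f z = c"
proof -
  define d where "d = min 1 (Im \<tau>)"
  have d: "0 < d" using \<tau> by (simp add: d_def)
  define U where "U = {z. z - u \<notin> period_lattice \<tau>}"
  \<comment> \<open>Distinct lifts of the puncture are at least \<open>d\<close> apart.\<close>
  have sep: "z = z'" if "z \<notin> U" "z' \<notin> U" "norm (z - z') < d" for z z'
  proof (rule ccontr)
    assume "z \<noteq> z'"
    moreover have "z - z' \<in> period_lattice \<tau>"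
      using that diff_in_period_lattice[of "z - u" \<tau> "z' - u"] by (simp add: U_def)
    ultimately have "d \<le> norm (z - z')"
      unfolding d_def by (intro norm_period_lattice_ge[OF \<tau>]) auto
    then show False using that by simp
  qed
  have "closed (- U)"
    using sep d by (intro discrete_imp_closed[of d]) (auto simp: dist_norm norm_minus_commute)
  then have "open U" by (simp add: closed_def)
  have u: "u \<notin> U" by (simp add: U_def)
  have ballU: "ball u d - {u} \<subseteq> U"
    using sep[OF u] by (fastforce simp: dist_norm)
  have "set_integrable lborel (ball u d) (\<lambda>z. (norm (f z))\<^sup>2)"
    using per by (intro set_integrable_ball_of_periodic[OF \<tau> _ int]) simp
  then obtain G where G: "G holomorphic_on ball u d" "\<And>z. z \<in> ball u d - {u} \<Longrightarrow> G z = f z"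
    using L2_isolated_singularity_removable[OF _ d] holomorphic_on_subset[OF hol[folded U_def] ballU]
    by metis
  define F where "F z = (if z \<in> U then f z else G u)" for z
  have U_per: "z + l \<in> U \<longleftrightarrow> z \<in> U" if "l \<in> period_lattice \<tau>" for z l
    using that add_in_period_lattice[OF that, of "z - u"] diff_in_period_lattice[OF _ that, of "z + l - u"]
    by (auto simp: U_def algebra_simps)
  have F_per: "F (z + l) = F z" if "l \<in> period_lattice \<tau>" for z l
    using that by (simp add: F_def U_per per)
  have F_ball: "F z = G z" if "z \<in> ball u d" for z
    using that u ballU G(2)[of z] by (cases "z = u") (auto simp: F_def)
  have "F holomorphic_on UNIV"
    unfolding holomorphic_on_def
  proof
    fix z :: complex
    show "F field_differentiable at z"
    proof (cases "z \<in> U")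
      case True
      have "F holomorphic_on U"
        using hol unfolding U_def[symmetric] by (rule holomorphic_transform) (simp add: F_def)
      then show ?thesis
        using True \<open>open U\<close> by (simp add: holomorphic_on_imp_differentiable_at)
    next
      case False
      then have l: "z - u \<in> period_lattice \<tau>" by (simp add: U_def)
      have "(\<lambda>x. G (x - (z - u))) holomorphic_on ball z d"
        by (rule holomorphic_on_compose_gen[OF _ G(1), unfolded o_def])
           (auto intro!: holomorphic_intros simp: dist_norm)
      then have "F holomorphic_on ball z d"
      proof (rule holomorphic_transform)
        fix x assume "x \<in> ball z d"
        then have "F (x - (z - u)) = G (x - (z - u))" by (intro F_ball) (simp add: dist_norm)
        then show "G (x - (z - u)) = F x" using F_per[OF l, of "x - (z - u)"] by simp
      qed
      then show ?thesis using d by (simp add: holomorphic_on_imp_differentiable_at)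
    qed
  qed
  moreover have "bounded (range F)"
  proof -
    let ?E = "(\<lambda>(s, t). of_real s + of_real t * \<tau>) ` ({0..1} \<times> {0..1} :: (real \<times> real) set)"
    have "compact ?E"
      by (intro compact_continuous_image compact_Times) (auto simp: split_beta intro!: continuous_intros)
    then have "compact (F ` ?E)"
      by (rule compact_continuous_image[rotated])
         (rule continuous_on_subset[OF holomorphic_on_imp_continuous_on[OF \<open>F holomorphic_on UNIV\<close>]], simp)
    moreover have "range F \<subseteq> F ` ?E"
    proof
      fix y assume "y \<in> range F"
      then obtain z where z: "y = F z" by auto
      define l where
        "l = of_int \<lfloor>Re z - Im z / Im \<tau> * Re \<tau>\<rfloor> + of_int \<lfloor>Im z / Im \<tau>\<rfloor> * \<tau>"
      have "F z = F (z - l)"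
        using F_per[of l "z - l"] by (simp add: l_def period_latticeI)
      moreover have "z - l \<in> ?E"
        using translate_into_fundamental_domain[OF \<tau>, of z, folded l_def]
        unfolding fundamental_domain_def by (fastforce simp: image_iff)
      ultimately show "y \<in> F ` ?E" using z by blast
    qed
    ultimately show ?thesis using bounded_subset compact_imp_bounded by blast
  qed
  ultimately have "F constant_on UNIV" by (rule Liouville_theorem)
  then obtain c where "\<And>z. F z = c" by (auto simp: constant_on_def)
  then show ?thesis by (intro that[of c]) (metis F_def U_def mem_Collect_eq)
qed

section \<open>The Bergman kernel of the punctured torus\<close>

text \<open>
  The value at the puncture itself is left free, as it is for elements of
  \<^const>\<open>L2_holomorphic_forms\<close>.
\<close>

definition constant_form :: "complex \<Rightarrow> complex \<Rightarrow> (complex set \<Rightarrow> complex) \<Rightarrow> complex \<Rightarrow> bool" where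
  "constant_form \<tau> u F c \<longleftrightarrow> (\<forall>z. z - u \<notin> period_lattice \<tau> \<longrightarrow> F (torus_point \<tau> z) = c)"

lemma constant_form_const [simp]: "constant_form \<tau> u (\<lambda>_. c) c"
  by (simp add: constant_form_def)

lemma constant_form_eq_if:
  assumes "constant_form \<tau> u F c"
  shows "F (torus_point \<tau> z) = (if z - u \<in> period_lattice \<tau> then F (torus_point \<tau> u) else c)"
proof (cases "z - u \<in> period_lattice \<tau>")
  case True
  then have "torus_point \<tau> z = torus_point \<tau> u" by (simp add: torus_point_eq_iff)
  with True show ?thesis by simp
next
  case False
  with assms show ?thesis by (simp add: constant_form_def)
qed

lemma L2_holomorphic_form_constant:
  assumes \<tau>: "0 < Im \<tau>" and F: "F \<in> L2_holomorphic_forms \<tau> u"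
  obtains c where "constant_form \<tau> u F c"
proof -
  have per: "torus_point \<tau> (z + l) = torus_point \<tau> z" if "l \<in> period_lattice \<tau>" for z l
    using that by (simp add: torus_point_eq_iff)
  obtain c where "\<And>z. z - u \<notin> period_lattice \<tau> \<Longrightarrow> F (torus_point \<tau> z) = c"
  proof (rule periodic_L2_holomorphic_constant[OF \<tau>])
    show "(\<lambda>z. F (torus_point \<tau> z)) holomorphic_on {z. z - u \<notin> period_lattice \<tau>}"
      using F by (simp add: L2_holomorphic_forms_def holomorphic_form_def torus_point_in_punctured_torus_iff)
  qed (use F per in \<open>auto simp: L2_holomorphic_forms_def\<close>)
  then show ?thesis by (intro that[of c]) (simp add: constant_form_def)
qed

text \<open>
  Integrals of constant forms do not see the value at the puncture, because its lifts form a
  countable set.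
\<close>

lemma set_integral_fundamental_domain_const_ae:
  fixes a b :: "'b :: {banach, second_countable_topology}"
  assumes \<tau>: "0 < Im \<tau>"
  shows "set_integrable lborel (fundamental_domain \<tau>) (\<lambda>z. if z - u \<in> period_lattice \<tau> then a else b)"
    and "(LINT z:fundamental_domain \<tau>|lborel. if z - u \<in> period_lattice \<tau> then a else b) = Im \<tau> *\<^sub>R b"
proof -
  let ?f = "\<lambda>z. indicator (fundamental_domain \<tau>) z *\<^sub>R (if z - u \<in> period_lattice \<tau> then a else b)"
  let ?g = "\<lambda>z. indicator (fundamental_domain \<tau>) z *\<^sub>R b"
  note [measurable] = fundamental_domain_borel[OF \<tau>]
  have cnt: "countable {z. z - u \<in> period_lattice \<tau>}"
  proof (rule countable_subset)
    show "{z. z - u \<in> period_lattice \<tau>} \<subseteq> (\<lambda>l. l + u) ` period_lattice \<tau>"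
      by (auto simp: image_iff) (metis diff_add_cancel)
  qed (simp add: countable_period_lattice)
  then have null: "{z. z - u \<in> period_lattice \<tau>} \<in> null_sets lborel"
    by (rule countable_imp_null_set_lborel)
  then have [measurable]: "Measurable.pred borel (\<lambda>z. z - u \<in> period_lattice \<tau>)"
    by (auto simp: pred_def)
  have meas: "?f \<in> borel_measurable lborel" "?g \<in> borel_measurable lborel"
    by measurable
  have ae: "AE z in lborel. ?f z = ?g z"
    using AE_not_in[OF null] by eventually_elim auto
  have "emeasure lborel (fundamental_domain \<tau>) < \<infinity>"
    by (simp add: emeasure_fundamental_domain[OF \<tau>])
  then have "integrable lborel ?g"
    by (intro integrable_scaleR_left) simp
  then show "set_integrable lborel (fundamental_domain \<tau>) (\<lambda>z. if z - u \<in> period_lattice \<tau> then a else b)"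
    unfolding set_integrable_def using integrable_cong_AE[OF meas ae] by simp
  have "(\<integral>z. ?f z \<partial>lborel) = (\<integral>z. ?g z \<partial>lborel)"
    by (rule integral_cong_AE[OF meas ae])
  also have "\<dots> = measure lborel (fundamental_domain \<tau>) *\<^sub>R b"
    using \<open>_ < \<infinity>\<close> by simp
  also have "measure lborel (fundamental_domain \<tau>) = Im \<tau>"
    using \<tau> by (simp add: measure_def emeasure_fundamental_domain)
  finally show "(LINT z:fundamental_domain \<tau>|lborel. if z - u \<in> period_lattice \<tau> then a else b) = Im \<tau> *\<^sub>R b"
    by (simp add: set_lebesgue_integral_def)
qed

lemma form_inner_of_constant:
  assumes \<tau>: "0 < Im \<tau>"
    and F: "constant_form \<tau> u F c"
    and G: "constant_form \<tau> u G d"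
  shows "form_inner \<tau> F G = 2 * of_real (Im \<tau>) * (c * cnj d)"
proof -
  have "(\<lambda>z. F (torus_point \<tau> z) * cnj (G (torus_point \<tau> z)))
    = (\<lambda>z. if z - u \<in> period_lattice \<tau> then F (torus_point \<tau> u) * cnj (G (torus_point \<tau> u)) else c * cnj d)"
    by (intro ext) (subst constant_form_eq_if[OF F], subst constant_form_eq_if[OF G], simp)
  then show ?thesis
    unfolding form_inner_def
    by (simp only: set_integral_fundamental_domain_const_ae[OF \<tau>] scaleR_conv_of_real mult.assoc)
qed

lemma form_norm_sq_of_constant:
  assumes \<tau>: "0 < Im \<tau>"
    and F: "constant_form \<tau> u F c"
  shows "form_norm_sq \<tau> F = 2 * Im \<tau> * (norm c)\<^sup>2"
proof -
  have "(\<lambda>z. (norm (F (torus_point \<tau> z)))\<^sup>2)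
    = (\<lambda>z. if z - u \<in> period_lattice \<tau> then (norm (F (torus_point \<tau> u)))\<^sup>2 else (norm c)\<^sup>2)"
    by (intro ext) (subst constant_form_eq_if[OF F], simp)
  then show ?thesis
    unfolding form_norm_sq_def
    by (simp only: set_integral_fundamental_domain_const_ae[OF \<tau>] real_scaleR_def mult.assoc)
qed

lemma constant_form_in_L2:
  assumes \<tau>: "0 < Im \<tau>"
  shows "(\<lambda>_. c) \<in> L2_holomorphic_forms \<tau> u"
  using set_integral_fundamental_domain_const_ae(1)[OF \<tau>, of u "(norm c)\<^sup>2" "(norm c)\<^sup>2"]
  by (simp add: L2_holomorphic_forms_def holomorphic_form_def)

lemma orthonormal_basis_constant_form:
  assumes \<tau>: "0 < Im \<tau>"
  shows "orthonormal_basis \<tau> u {\<lambda>_. of_real (1 / sqrt (2 * Im \<tau>))}"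
proof -
  define k :: complex where "k = of_real (1 / sqrt (2 * Im \<tau>))"
  have k0: "k \<noteq> 0" using \<tau> by (simp add: k_def)
  have "k * cnj k = of_real (1 / (2 * Im \<tau>))"
    using \<tau> by (simp add: k_def flip: of_real_mult real_sqrt_mult)
  then have inner: "form_inner \<tau> (\<lambda>_. k) (\<lambda>_. k) = 1"
    using \<tau> by (simp add: form_inner_of_constant[OF \<tau>, of u _ k _ k])
  have "\<exists>S c. finite S \<and> S \<subseteq> {\<lambda>_. k} \<and> form_norm_sq \<tau> (\<lambda>p. F p - (\<Sum>G\<in>S. c G * G p)) < e"
    if F: "F \<in> L2_holomorphic_forms \<tau> u" and e: "0 < e" for F e
  proof -
    obtain c where c: "constant_form \<tau> u F c"
      by (rule L2_holomorphic_form_constant[OF \<tau> F])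
    have "form_norm_sq \<tau> (\<lambda>p. F p - c) = 2 * Im \<tau> * (norm (0 :: complex))\<^sup>2"
      using c by (intro form_norm_sq_of_constant[OF \<tau>, of u]) (simp add: constant_form_def)
    then show ?thesis
      using k0 e by (intro exI[of _ "{\<lambda>_. k}"] exI[of _ "\<lambda>_. c / k"]) simp
  qed
  then show ?thesis
    unfolding orthonormal_basis_def k_def[symmetric]
    using inner constant_form_in_L2[OF \<tau>] by auto
qed

text \<open>
  The space of forms is one-dimensional up to values at the puncture, so any orthonormal basis, and
  in particular the one chosen in the definition, consists of a single form of constant modulus
  \<open>1 / sqrt (2 * Im \<tau>)\<close>.  Two forms that differ only at the puncture have inner product 1 and hence
  cannot both belong to a basis.
\<close>

lemma bergman_kernel_eq:
  assumes \<tau>: "0 < Im \<tau>" and w: "w - u \<notin> period_lattice \<tau>"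
  shows "bergman_kernel \<tau> u w = 1 / (2 * Im \<tau>)"
proof -
  define B where "B = (SOME B. orthonormal_basis \<tau> u B)"
  have B: "orthonormal_basis \<tau> u B"
    unfolding B_def using orthonormal_basis_constant_form[OF \<tau>] by (rule someI)
  then have L2: "\<And>F. F \<in> B \<Longrightarrow> F \<in> L2_holomorphic_forms \<tau> u"
    and orth: "\<And>F G. F \<in> B \<Longrightarrow> G \<in> B \<Longrightarrow> form_inner \<tau> F G = (if F = G then 1 else 0)"
    and dense: "\<And>F e. F \<in> L2_holomorphic_forms \<tau> u \<Longrightarrow> 0 < e \<Longrightarrow> \<exists>S c. finite S \<and> S \<subseteq> B \<and>
        form_norm_sq \<tau> (\<lambda>p. F p - (\<Sum>G\<in>S. c G * G p)) < e"
    unfolding orthonormal_basis_def by blast+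
  have inner: "form_inner \<tau> F G = 2 * of_real (Im \<tau>) * (F (torus_point \<tau> w) * cnj (G (torus_point \<tau> w)))"
    if FG: "F \<in> B" "G \<in> B" for F G
  proof -
    obtain c where c: "constant_form \<tau> u F c"
      by (rule L2_holomorphic_form_constant[OF \<tau> L2[OF FG(1)]])
    obtain d where d: "constant_form \<tau> u G d"
      by (rule L2_holomorphic_form_constant[OF \<tau> L2[OF FG(2)]])
    have "F (torus_point \<tau> w) = c" "G (torus_point \<tau> w) = d"
      using c d w by (simp_all add: constant_form_def)
    then show ?thesis using form_inner_of_constant[OF \<tau> c d] by simp
  qed
  have "B \<noteq> {}"
  proof
    assume "B = {}"
    then have "form_norm_sq \<tau> (\<lambda>_. 1) < 2 * Im \<tau>"
      using dense[OF constant_form_in_L2[OF \<tau>], of "2 * Im \<tau>" 1] \<tau> by simp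
    then show False using form_norm_sq_of_constant[OF \<tau>, of u "\<lambda>_. 1" 1] by simp
  qed
  then obtain F where F: "F \<in> B" by blast
  have unit: "2 * of_real (Im \<tau>) * (F (torus_point \<tau> w) * cnj (F (torus_point \<tau> w))) = 1"
    using inner[OF F F] orth[OF F F] by simp
  have "G = F" if G: "G \<in> B" for G
  proof (rule ccontr)
    assume "G \<noteq> F"
    then have "2 * of_real (Im \<tau>) * (F (torus_point \<tau> w) * cnj (G (torus_point \<tau> w))) = 0"
      using inner[OF F G] orth[OF F G] by auto
    moreover have "F (torus_point \<tau> w) \<noteq> 0" using unit by auto
    ultimately have "G (torus_point \<tau> w) = 0" using \<tau> by auto
    then show False using inner[OF G G] orth[OF G G] by simp
  qed
  then have "B = {F}" using F by blast
  then have "bergman_kernel \<tau> u w = (norm (F (torus_point \<tau> w)))\<^sup>2"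
    by (simp add: bergman_kernel_def B_def[symmetric])
  also have "of_real (2 * Im \<tau> * (norm (F (torus_point \<tau> w)))\<^sup>2) = (1 :: complex)"
    using unit by (simp add: complex_norm_square del: of_real_power)
  then have "2 * Im \<tau> * (norm (F (torus_point \<tau> w)))\<^sup>2 = 1"
    using of_real_eq_1_iff by blast
  then have "(norm (F (torus_point \<tau> w)))\<^sup>2 = 1 / (2 * Im \<tau>)"
    using \<tau> by (simp add: field_simps)
  finally show ?thesis .
qed

section \<open>The theta product and the fundamental metric for large imaginary part\<close>

text \<open>
  Separating the infinite product from the prefactor \<open>2 q\<^sup>1\<^sup>/\<^sup>4 sin (\<pi> z)\<close> of \<open>\<theta>\<^sub>1\<close> gives a function of the
  nome that is continuous at \<open>q = 0\<close>; in the metric only quotients of theta values occur, so that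
  the factor \<open>q\<^sup>1\<^sup>/\<^sup>4\<close> cancels.
\<close>

definition theta_product :: "complex \<Rightarrow> complex \<Rightarrow> complex" where
  "theta_product z q = (\<Prod>k. (1 - q ^ (2 * Suc k)) *
     (1 - 2 * cos (2 * of_real pi * z) * q ^ (2 * Suc k) + q ^ (4 * Suc k)))"

lemma theta1_eq:
  "theta1 z \<tau> = 2 * exp (of_real pi * \<i> * \<tau> / 4) * sin (of_real pi * z) *
     theta_product z (exp (of_real pi * \<i> * \<tau>))"
  by (simp only: theta1_def theta_product_def Let_def)

lemma theta_product_0 [simp]: "theta_product z 0 = 1"
  by (simp add: theta_product_def power_0_left del: mult_Suc_right)

text \<open>
  Joint continuity covers both limits below: \<open>z\<close> tending to the pole with \<open>q\<close> fixed, and \<open>q\<close> tending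
  to \<open>0\<close> with \<open>z\<close> fixed.  With \<open>x = q ^ (2 (k + 1))\<close> and \<open>c = cos (2 \<pi> z)\<close> the \<open>k\<close>-th factor is
  \<open>(1 - x) (1 - 2 c x + x\<^sup>2)\<close>, which differs from \<open>1\<close> by \<open>O(x)\<close>; for \<open>norm q \<le> 1/2\<close> this is
  dominated by a geometric series, so that the product converges uniformly.
\<close>

lemma continuous_on_theta_product:
  assumes K: "compact K"
  shows "continuous_on (K \<times> cball 0 (1/2)) (\<lambda>(z, q). theta_product z q)"
proof -
  let ?A = "K \<times> cball 0 (1/2) :: (complex \<times> complex) set"
  define f where "f k p = (1 - snd p ^ (2 * Suc k)) *
     (1 - 2 * cos (2 * of_real pi * fst p) * snd p ^ (2 * Suc k) + snd p ^ (4 * Suc k))" for k and p :: "complex \<times> complex"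
  have cont: "continuous_on X (f k)" for k X
    unfolding f_def by (intro continuous_intros)
  have "compact ((\<lambda>z. cos (2 * of_real pi * z)) ` K)"
    by (intro compact_continuous_image continuous_intros K)
  then have "\<exists>C. \<forall>z\<in>K. norm (cos (2 * of_real pi * z)) \<le> C"
    by (auto dest!: compact_imp_bounded simp: bounded_iff)
  then obtain C where C: "\<And>z. z \<in> K \<Longrightarrow> norm (cos (2 * of_real pi * z)) \<le> C"
    by meson
  have bound: "norm (f k p - 1) \<le> (3 + 4 * C) * (1/4) ^ k" if p: "p \<in> ?A" for k p
  proof -
    define x where "x = snd p ^ (2 * Suc k)"
    define c where "c = cos (2 * of_real pi * fst p)"
    have c: "norm c \<le> C" using C p by (auto simp: c_def)
    have "norm x = (norm (snd p) ^ 2) ^ Suc k" by (simp only: x_def norm_power power_mult)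
    also have "\<dots> \<le> ((1/2) ^ 2) ^ Suc k"
      using p by (intro power_mono) auto
    also have "\<dots> = (1/4) ^ Suc k" by (simp add: power2_eq_square)
    finally have x: "norm x \<le> (1/4) ^ Suc k" .
    also have "(1/4 :: real) ^ Suc k \<le> 1" by (rule power_le_one) auto
    finally have x1: "norm x \<le> 1" .
    have "4 * Suc k = 2 * Suc k * 2" by simp
    then have "f k p = (1 - x) * (1 - 2 * c * x + x ^ 2)"
      by (simp only: f_def x_def c_def power_mult)
    then have "f k p - 1 = x * (- 1 - 2 * c + x + 2 * c * x - x ^ 2)"
      by (simp add: algebra_simps power2_eq_square)
    then have "norm (f k p - 1) = norm x * norm (- 1 - 2 * c + x + 2 * c * x - x ^ 2)"
      by (simp add: norm_mult)
    also have "norm (- 1 - 2 * c + x + 2 * c * x - x ^ 2)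
        \<le> norm (- 1 - 2 * c + x + 2 * c * x) + norm (x ^ 2)" by (rule norm_triangle_ineq4)
    also have "norm (- 1 - 2 * c + x + 2 * c * x) \<le> norm (- 1 - 2 * c + x) + norm (2 * c * x)"
      by (rule norm_triangle_ineq)
    also have "norm (- 1 - 2 * c + x) \<le> norm (- 1 - 2 * c) + norm x" by (rule norm_triangle_ineq)
    also have "norm (- 1 - 2 * c) \<le> norm (- 1 :: complex) + norm (2 * c)" by (rule norm_triangle_ineq4)
    also have "norm (- 1 :: complex) + norm (2 * c) + norm x + norm (2 * c * x) + norm (x ^ 2) \<le> 3 + 4 * C"
    proof -
      have "norm c * norm x \<le> C * 1" using c x1 by (intro mult_mono) (auto intro: order_trans[OF norm_ge_zero])
      moreover have "norm x ^ 2 \<le> 1" using x1 by (simp add: power_le_one)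
      ultimately show ?thesis using c x1 by (simp add: norm_mult norm_power)
    qed
    finally have "norm (f k p - 1) \<le> norm x * (3 + 4 * C)" by (simp add: mult_left_mono)
    also have "\<dots> \<le> (1/4) ^ k * (3 + 4 * C)"
    proof (rule mult_right_mono)
      show "norm x \<le> (1/4) ^ k" using x by (rule order_trans) simp
      show "0 \<le> 3 + 4 * C" using order_trans[OF norm_ge_zero c] by simp
    qed
    finally show ?thesis by (simp add: mult.commute)
  qed
  have summ: "summable (\<lambda>k. (3 + 4 * C) * (1/4) ^ k)"
    by (intro summable_mult summable_geometric) simp
  have "uniformly_convergent_on ?A (\<lambda>N p. \<Sum>k<N. norm (f k p - 1))"
    by (rule Weierstrass_m_test'[OF _ summ]) (use bound in auto)
  then have "uniformly_convergent_on ?A (\<lambda>N p. \<Prod>k<N. f k p)"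
    by (intro uniformly_convergent_on_prod' cont compact_Times K compact_cball)
  then obtain L where L: "uniform_limit ?A (\<lambda>N p. \<Prod>k<N. f k p) L sequentially"
    by (auto simp: uniformly_convergent_on_def)
  have "continuous_on ?A L"
    by (rule uniform_limit_theorem[OF _ L]) (auto intro!: always_eventually continuous_intros cont)
  moreover have "L p = (case p of (z, q) \<Rightarrow> theta_product z q)" if p: "p \<in> ?A" for p
  proof -
    have "summable (\<lambda>k. norm (f k p - 1))"
      by (rule summable_comparison_test'[OF summ]) (use bound[OF p] in auto)
    then have "convergent_prod (\<lambda>k. f k p)"
      by (intro abs_convergent_prod_imp_convergent_prod) (simp add: abs_convergent_prod_conv_summable)
    then have "(\<lambda>N. \<Prod>k\<le>N. f k p) \<longlonglongrightarrow> (\<Prod>k. f k p)"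
      by (rule convergent_prod_LIMSEQ)
    moreover have "(\<lambda>N. \<Prod>k<N. f k p) \<longlonglongrightarrow> L p"
      by (rule tendsto_uniform_limitI[OF L p])
    then have "(\<lambda>N. \<Prod>k\<le>N. f k p) \<longlonglongrightarrow> L p"
      by (simp add: LIMSEQ_lessThan_iff_atMost)
    ultimately have "L p = (\<Prod>k. f k p)" by (rule LIMSEQ_unique[rotated])
    then show ?thesis by (simp add: f_def theta_product_def split_beta)
  qed
  ultimately show ?thesis by (simp cong: continuous_on_cong)
qed

lemma isCont_theta_product:
  assumes q: "norm q \<le> 1/2"
  shows "isCont (\<lambda>z. theta_product z q) z"
proof -
  have "continuous_on (cball z 1) ((\<lambda>(z, q). theta_product z q) \<circ> (\<lambda>z. (z, q)))"
    using q by (intro continuous_on_compose continuous_intros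
        continuous_on_subset[OF continuous_on_theta_product[of "cball z 1"]]) auto
  then show ?thesis
    by (intro continuous_on_interior[of "cball z 1"]) (auto simp: o_def)
qed

lemma theta_product_tendsto_1: "((\<lambda>q. theta_product z q) \<longlongrightarrow> 1) (nhds 0)"
proof -
  have "continuous_on (cball 0 (1/2)) ((\<lambda>(z, q). theta_product z q) \<circ> (\<lambda>q. (z, q)))"
    by (intro continuous_on_compose continuous_intros
        continuous_on_subset[OF continuous_on_theta_product[of "{z}"]]) auto
  then have "isCont (\<lambda>q. theta_product z q) 0"
    by (intro continuous_on_interior[of "cball 0 (1/2)"]) (auto simp: o_def)
  then have "((\<lambda>q. theta_product z q) \<longlongrightarrow> theta_product z 0) (nhds 0)"
    by (simp only: isCont_def tendsto_at_iff_tendsto_nhds)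
  then show ?thesis by simp
qed

text \<open>
  This is \<open>norm (\<theta>\<^sub>1'(0) / \<theta>\<^sub>1(w - u))\<close>.  The products do not vanish once \<open>Im \<tau>\<close> is large, by
  \<open>theta_product_tendsto_1\<close>.
\<close>

lemma fundamental_metric_eq:
  fixes \<tau> u w :: complex
  defines "q \<equiv> exp (of_real pi * \<i> * \<tau>)"
  assumes q: "norm q \<le> 1/2" and s: "sin (of_real pi * (w - u)) \<noteq> 0"
    and P: "theta_product 0 q \<noteq> 0" "theta_product (w - u) q \<noteq> 0"
  shows "fundamental_metric \<tau> u w =
    norm (of_real pi * theta_product 0 q / (sin (of_real pi * (w - u)) * theta_product (w - u) q))"
proof -
  \<comment> \<open>The quotient of theta values, divided by its zero \<open>z - w\<close>; the common prefactors have cancelled.\<close>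
  define R where "R z = sin (of_real pi * (z - w)) / (z - w) * theta_product (z - w) q /
    (sin (of_real pi * (z - u)) * theta_product (z - u) q)" for z
  define l where "l = of_real pi * theta_product 0 q / (sin (of_real pi * (w - u)) * theta_product (w - u) q)"
  have "((\<lambda>z. sin (of_real pi * (z - w))) has_field_derivative of_real pi) (at w)"
    by (auto intro!: derivative_eq_intros)
  then have sin_lim: "((\<lambda>z. sin (of_real pi * (z - w)) / (z - w)) \<longlongrightarrow> of_real pi) (at w)"
    by (simp add: has_field_derivative_iff)
  have prod_lim: "((\<lambda>z. theta_product (z - a) q) \<longlongrightarrow> theta_product (w - a) q) (at w)" for a
    by (rule isCont_tendsto_compose[OF isCont_theta_product[OF q]]) (intro tendsto_intros)
  have R: "(R \<longlongrightarrow> l) (at w)"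
    unfolding R_def l_def using s P
    by (intro tendsto_intros sin_lim prod_lim prod_lim[of w, simplified]) auto
  have l0: "l \<noteq> 0" using s P by (simp add: l_def)
  have "((\<lambda>z. ln (norm (R z))) \<longlongrightarrow> ln (norm l)) (at w)"
    using R l0 by (intro tendsto_intros) auto
  moreover have "eventually (\<lambda>z. ln (norm (R z)) = evans_selberg_potential \<tau> u w z - ln (norm (z - w))) (at w)"
    using tendsto_imp_eventually_ne[OF R l0] eventually_neq_at_within[of w w UNIV]
  proof eventually_elim
    case (elim z)
    have "evans_selberg_potential \<tau> u w z = ln (norm (R z * (z - w)))"
      using elim by (simp add: evans_selberg_potential_def theta1_eq R_def flip: q_def)
    also have "\<dots> = ln (norm (R z)) + ln (norm (z - w))"
      using elim by (simp add: norm_mult ln_mult)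
    finally show ?case by simp
  qed
  ultimately have "((\<lambda>z. evans_selberg_potential \<tau> u w z - ln (norm (z - w))) \<longlongrightarrow> ln (norm l)) (at w)"
    by (rule Lim_transform_eventually)
  then have "Lim (at w) (\<lambda>z. evans_selberg_potential \<tau> u w z - ln (norm (z - w))) = ln (norm l)"
    by (intro tendsto_Lim) auto
  then show ?thesis using l0 by (simp add: fundamental_metric_def l_def)
qed

lemma nome_tendsto_0: "((\<lambda>\<tau>. exp (of_real pi * \<i> * \<tau>)) \<longlongrightarrow> 0) (filtercomap Im at_top)"
proof (rule tendsto_norm_zero_cancel)
  have "((\<lambda>y. exp (- (pi * y))) \<longlongrightarrow> 0) at_top"
    by (intro filterlim_compose[OF exp_at_bot] filterlim_compose[OF filterlim_uminus_at_bot_at_top]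
        filterlim_tendsto_pos_mult_at_top[OF tendsto_const]) (auto simp: filterlim_ident)
  then have "((\<lambda>\<tau>. exp (- (pi * Im \<tau>))) \<longlongrightarrow> 0) (filtercomap Im at_top)"
    by (rule filterlim_compose) (rule filterlim_filtercomap)
  then show "((\<lambda>\<tau>. norm (exp (of_real pi * \<i> * \<tau>))) \<longlongrightarrow> 0) (filtercomap Im at_top)"
    by (simp add: norm_exp_eq_Re)
qed

lemma fundamental_metric_tendsto:
  assumes s: "sin (of_real pi * (w - u)) \<noteq> 0"
  shows "((\<lambda>\<tau>. fundamental_metric \<tau> u w) \<longlongrightarrow> pi / norm (sin (of_real pi * (w - u))))
    (filtercomap Im at_top)"
proof -
  let ?q = "\<lambda>\<tau>. exp (of_real pi * \<i> * \<tau>)"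
  have P: "((\<lambda>\<tau>. theta_product z (?q \<tau>)) \<longlongrightarrow> 1) (filtercomap Im at_top)" for z
    by (rule filterlim_compose[OF theta_product_tendsto_1 nome_tendsto_0])
  have "((\<lambda>\<tau>. norm (of_real pi * theta_product 0 (?q \<tau>) /
      (sin (of_real pi * (w - u)) * theta_product (w - u) (?q \<tau>))))
      \<longlongrightarrow> norm (of_real pi * 1 / (sin (of_real pi * (w - u)) * 1))) (filtercomap Im at_top)"
    using s by (intro tendsto_intros P) auto
  moreover have "eventually (\<lambda>\<tau>. norm (of_real pi * theta_product 0 (?q \<tau>) /
      (sin (of_real pi * (w - u)) * theta_product (w - u) (?q \<tau>))) = fundamental_metric \<tau> u w) (filtercomap Im at_top)"
  proof -
    have "eventually (\<lambda>\<tau>. norm (?q \<tau>) < 1/2) (filtercomap Im at_top)"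
      using tendsto_norm[OF nome_tendsto_0] by (intro order_tendstoD(2)) auto
    moreover have ne: "eventually (\<lambda>\<tau>. theta_product z (?q \<tau>) \<noteq> 0) (filtercomap Im at_top)" for z
      by (rule tendsto_imp_eventually_ne[OF P]) simp
    note ne[of 0] ne[of "w - u"]
    ultimately show ?thesis
      by eventually_elim (rule fundamental_metric_eq[OF _ s, symmetric], simp_all)
  qed
  ultimately show ?thesis
    by (auto simp: norm_divide norm_mult intro: Lim_transform_eventually)
qed

section \<open>The limit of the quotient\<close>

theorem theorem1p2:
  fixes u w :: complex
  shows "filterlim (\<lambda>\<tau>. pi * bergman_kernel \<tau> u w / (fundamental_metric \<tau> u w)\<^sup>2) (at_right 0)
           (inf (filtercomap Im at_top)
                (principal {\<tau>. Im \<tau> > 0 \<and> torus_point \<tau> w \<in> punctured_torus \<tau> u}))"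
proof (cases "sin (of_real pi * (w - u)) = 0")
  case True
  \<comment> \<open>Here \<open>w - u\<close> is an integer, so \<open>w\<close> lies over the puncture for every \<open>\<tau>\<close> and the filter is trivial.\<close>
  then obtain n :: int where "of_real pi * (w - u) = of_real (of_int n * pi)"
    by (auto simp: sin_eq_0 mult.commute)
  then have "w - u = of_int n" by (simp add: mult.commute)
  then have "w - u \<in> period_lattice \<tau>" for \<tau>
    using period_latticeI[of n 0 \<tau>] by simp
  then show ?thesis by (simp add: torus_point_in_punctured_torus_iff filterlim_def)
next
  case False
  define F :: "complex filter" where "F = inf (filtercomap Im at_top)
                (principal {\<tau>. Im \<tau> > 0 \<and> torus_point \<tau> w \<in> punctured_torus \<tau> u})"
  have F_le: "F \<le> filtercomap Im at_top" by (simp add: F_def)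
  have F_ev: "eventually (\<lambda>\<tau>. Im \<tau> > 0 \<and> w - u \<notin> period_lattice \<tau>) F"
    unfolding F_def eventually_inf_principal
    by (simp add: torus_point_in_punctured_torus_iff)
  define c where "c = pi / norm (sin (of_real pi * (w - u)))"
  have c: "0 < c" using False by (simp add: c_def)
  have c_lim: "((\<lambda>\<tau>. fundamental_metric \<tau> u w) \<longlongrightarrow> c) F"
    unfolding c_def by (rule tendsto_mono[OF F_le fundamental_metric_tendsto[OF False]])
  have "filterlim Im at_top F"
    using F_le filterlim_filtercomap filterlim_mono by blast
  then have "((\<lambda>\<tau>. 1 / (2 * Im \<tau>)) \<longlongrightarrow> 0) F"
    by (intro tendsto_divide_0[OF tendsto_const] filterlim_at_top_imp_at_infinity
        filterlim_tendsto_pos_mult_at_top[OF tendsto_const]) auto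
  then have K_lim: "((\<lambda>\<tau>. bergman_kernel \<tau> u w) \<longlongrightarrow> 0) F"
    by (rule Lim_transform_eventually)
       (use F_ev in \<open>eventually_elim, simp add: bergman_kernel_eq\<close>)
  have "((\<lambda>\<tau>. pi * bergman_kernel \<tau> u w / (fundamental_metric \<tau> u w)\<^sup>2) \<longlongrightarrow> pi * 0 / c\<^sup>2) F"
    using c by (intro tendsto_intros K_lim c_lim) auto
  moreover have "eventually (\<lambda>\<tau>. 0 < pi * bergman_kernel \<tau> u w / (fundamental_metric \<tau> u w)\<^sup>2) F"
    using F_ev order_tendstoD(1)[OF c_lim c]
    by eventually_elim (simp add: bergman_kernel_eq)
  ultimately show ?thesis
    unfolding F_def[symmetric] by (intro tendsto_imp_filterlim_at_right) simp_all
qed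

end
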